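(* Let $\Omega$ be a commutative semigroup, let $(V;\rho,\theta)$ be a representation of a Lie-Yamaguti algebra $(L,[\cdot,\cdot],\{\cdot,\cdot,\cdot\})$, let $\Gamma=(\Gamma_1,\Gamma_2)$ be a $(2,3)$-cocycle of $L$ with coefficients in $V$, and let $\{T_\alpha:V\to L\}_{\alpha\in\Omega}$ be a $\Gamma$-twisted Rota-Baxter family. Equip $V$ with the $\Omega$-Lie-Yamaguti algebra structure $$[u,v]_{\alpha,\beta}=\rho(T_\alpha u)v-\rho(T_\beta v)u+\Gamma_1(T_\alpha u,T_\beta v),$$ $$\{u,v,w\}_{\alpha,\beta,\gamma}=D(T_\alpha u,T_\beta v)w+\theta(T_\beta v,T_\gamma w)u-\theta(T_\alpha u,T_\gamma w)v+\Gamma_2(T_\alpha u,T_\beta v,T_\gamma w).$$ For $\alpha,\beta,\varsigma\in\Omega$ define $\varrho_{\alpha,\varsigma}:V\times L\to L$ and $\vartheta_{\alpha,\beta,\varsigma}:V\times V\times L\to L$ by $$\varrho_{\alpha,\varsigma}(u,x)=[T_\alpha u,x]+T_{\varsigma\alpha}\big(\rho(x)u+\Gamma_1(x,T_\alpha u)\big),$$ $$\vartheta_{\alpha,\beta,\varsigma}(u,v,x)=\{x,T_\alpha u,T_\beta v\}-T_{\varsigma\alpha\beta}\big(D(x,T_\alpha u)v-\theta(x,T_\beta v)u+\Gamma_2(x,T_\alpha u,T_\beta v)\big).$$ Then $(L,\{\varrho_{\alpha,\varsigma},\vartheta_{\alpha,\beta,\varsigma}\}_{\alpha,\beta,\varsigma\in\Omega})$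 is a representation of the $\Omega$-Lie-Yamaguti algebra $(V,\{[\cdot,\cdot]_{\alpha,\beta},\{\cdot,\cdot,\cdot\}_{\alpha,\beta,\gamma}\}_{\alpha,\beta,\gamma\in\Omega})$.
   Context: All vector spaces are over an algebraically closed field $\mathbb K$ of characteristic different from $2$ and $3$. **Lie-Yamaguti algebra.** A vector space $L$ with a bilinear bracket $[\cdot,\cdot]:\wedge^2L\to L$ and a trilinear bracket $\{\cdot,\cdot,\cdot\}:\wedge^2L\otimes L\to L$ (skew-symmetric in the first two arguments) such that for all $x,y,z,a,b\in L$: (1) $[[x,y],z]+[[y,z],x]+[[z,x],y]+\{x,y,z\}+\{z,x,y\}+\{y,z,x\}=0$; (2) $\{[x,y],z,a\}+\{[y,z],x,a\}+\{[z,x],y,a\}=0$; (3) $\{a,b,[x,y]\}=[\{a,b,x\},y]+[x,\{a,b,y\}]$; (4) $\{a,b,\{x,y,z\}\}=\{\{a,b,x\},y,z\}+\{x,\{a,b,y\},z\}+\{x,y,\{a,b,z\}\}$. **Representation.** A representation of $L$ on a vector space $V$ is a linear map $\rho:L\to\mathrm{End}(V)$ and a bilinear map $\theta:L\times L\to\mathrm{End}(V)$ such that, with $D(x,y)=\theta(y,x)-\theta(x,y)-\rho([x,y])+\rho(x)\rho(y)-\rho(y)\rho(x)$, for all $x,y,z,a,b\in L$: $\theta([x,y],z)-\theta(x,z)\rho(y)+\theta(y,z)\rho(x)=0$; $D(x,y)\rho(z)-\rho(z)D(x,y)-\rho(\{x,y,z\})=0$; $\theta(x,[y,z])-\rho(y)\theta(x,z)+\rho(z)\theta(x,y)=0$;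 $D(a,b)\theta(x,y)-\theta(x,y)D(a,b)-\theta(\{a,b,x\},y)-\theta(x,\{a,b,y\})=0$; $\theta(a,\{x,y,z\})-\theta(y,z)\theta(a,x)+\theta(x,z)\theta(a,y)-D(x,y)\theta(a,z)=0$. **$(2,3)$-cocycle.** A pair $\Gamma=(\Gamma_1,\Gamma_2)\in\mathrm{Hom}(\wedge^2L,V)\times\mathrm{Hom}(\wedge^2L\otimes L,V)$ such that for all $x_1,y_1,x_2,y_2,z\in L$: $-\rho(x_1)\Gamma_1(y_1,z)-\rho(y_1)\Gamma_1(z,x_1)-\rho(z)\Gamma_1(x_1,y_1)+\Gamma_1([x_1,y_1],z)+\Gamma_1([y_1,z],x_1)+\Gamma_1([z,x_1],y_1)+\Gamma_2(x_1,y_1,z)+\Gamma_2(y_1,z,x_1)+\Gamma_2(z,x_1,y_1)=0$; $\theta(x_1,y_2)\Gamma_1(y_1,x_2)+\theta(y_1,y_2)\Gamma_1(x_2,x_1)+\theta(x_2,y_2)\Gamma_1(x_1,y_1)+\Gamma_2([x_1,y_1],x_2,y_2)+\Gamma_2([y_1,x_2],x_1,y_2)+\Gamma_2([x_2,x_1],y_1,y_2)=0$; $-\rho(x_2)\Gamma_2(x_1,y_1,y_2)+\rho(y_2)\Gamma_2(x_1,y_1,x_2)+\Gamma_2(x_1,y_1,[x_2,y_2])+D(x_1,y_1)\Gamma_1(x_2,y_2)-\Gamma_1(\{x_1,y_1,x_2\},y_2)-\Gamma_1(x_2,\{x_1,y_1,y_2\})=0$; $-\theta(y_2,z)\Gamma_2(x_1,y_1,x_2)+\theta(x_2,z)\Gamma_2(x_1,y_1,y_2)+D(x_1,y_1)\Gamma_2(x_2,y_2,z)-D(x_2,y_2)\Gamma_2(x_1,y_1,z)-\Gamma_2(\{x_1,y_1,x_2\},y_2,z)-\Gamma_2(x_2,\{x_1,y_1,y_2\},z)+\Gamma_2(x_1,y_1,\{x_2,y_2,z\})-\Gamma_2(x_2,y_2,\{x_1,y_1,z\})=0$.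 **$\Gamma$-twisted Rota-Baxter family.** A collection of linear maps $\{T_\alpha:V\to L\}_{\alpha\in\Omega}$ such that for all $u,v,w\in V$, $\alpha,\beta,\gamma\in\Omega$: $[T_\alpha u,T_\beta v]=T_{\alpha\beta}\big(\rho(T_\alpha u)v-\rho(T_\beta v)u+\Gamma_1(T_\alpha u,T_\beta v)\big)$; $\{T_\alpha u,T_\beta v,T_\gamma w\}=T_{\alpha\beta\gamma}\big(D(T_\alpha u,T_\beta v)w-\theta(T_\alpha u,T_\gamma w)v+\theta(T_\beta v,T_\gamma w)u+\Gamma_2(T_\alpha u,T_\beta v,T_\gamma w)\big)$. **$\Omega$-Lie-Yamaguti algebra.** A vector space $A$ with bilinear operations $[\cdot,\cdot]_{\alpha,\beta}$ and trilinear operations $\{\cdot,\cdot,\cdot\}_{\alpha,\beta,\gamma}$ ($\alpha,\beta,\gamma\in\Omega$) such that for all $x,y,z,a,b\in A$ and all indices in $\Omega$: $[x,y]_{\alpha,\beta}=-[y,x]_{\beta,\alpha}$, $\{x,y,z\}_{\alpha,\beta,\gamma}=-\{y,x,z\}_{\beta,\alpha,\gamma}$; $[[x,y]_{\alpha,\beta},z]_{\alpha\beta,\gamma}+[[y,z]_{\beta,\gamma},x]_{\beta\gamma,\alpha}+[[z,x]_{\gamma,\alpha},y]_{\gamma\alpha,\beta}+\{x,y,z\}_{\alpha,\beta,\gamma}+\{y,z,x\}_{\beta,\gamma,\alpha}+\{z,x,y\}_{\gamma,\alpha,\beta}=0$; $\{[x,y]_{\alpha,\beta},z,a\}_{\alpha\beta,\gamma,\varsigma}+\{[y,z]_{\beta,\gamma},x,a\}_{\beta\gamma,\alpha,\varsigma}+\{[z,x]_{\gamma,\alpha},y,a\}_{\gamma\alpha,\beta,\varsigma}=0$;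 $\{a,x,[y,z]_{\beta,\gamma}\}_{\varsigma,\alpha,\beta\gamma}=[\{a,x,y\}_{\varsigma,\alpha,\beta},z]_{\varsigma\alpha\beta,\gamma}+[y,\{a,x,z\}_{\varsigma,\alpha,\gamma}]_{\beta,\varsigma\alpha\gamma}$; $\{a,b,\{x,y,z\}_{\alpha,\beta,\gamma}\}_{\varsigma,\tau,\alpha\beta\gamma}=\{\{a,b,x\}_{\varsigma,\tau,\alpha},y,z\}_{\varsigma\tau\alpha,\beta,\gamma}+\{x,\{a,b,y\}_{\varsigma,\tau,\beta},z\}_{\alpha,\varsigma\tau\beta,\gamma}+\{x,y,\{a,b,z\}_{\varsigma,\tau,\gamma}\}_{\alpha,\beta,\varsigma\tau\gamma}$. (The structure on $V$ in the claim is an $\Omega$-Lie-Yamaguti algebra.) **Representation of an $\Omega$-Lie-Yamaguti algebra** $A$ on a vector space $W$: bilinear maps $\rho_{\alpha,\varsigma}:A\times W\to W$ and trilinear maps $\theta_{\alpha,\beta,\varsigma}:A\times A\times W\to W$ ($\alpha,\beta,\varsigma\in\Omega$) such that, with $D_{\alpha,\beta,\varsigma}(x,y,u)=\theta_{\beta,\alpha,\varsigma}(y,x,u)-\theta_{\alpha,\beta,\varsigma}(x,y,u)-\rho_{\alpha\beta,\varsigma}([x,y]_{\alpha,\beta},u)+\rho_{\alpha,\beta\varsigma}(x,\rho_{\beta,\varsigma}(y,u))-\rho_{\beta,\alpha\varsigma}(y,\rho_{\alpha,\varsigma}(x,u))$, for all $x,y,z,a\in A$, $u\in W$, $\alpha,\beta,\gamma,\varsigma,\tau\in\Omega$: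 $\theta_{\alpha\beta,\gamma,\varsigma}([x,y]_{\alpha,\beta},z,u)-\theta_{\alpha,\gamma,\beta\varsigma}(x,z,\rho_{\beta,\varsigma}(y,u))+\theta_{\beta,\gamma,\alpha\varsigma}(y,z,\rho_{\alpha,\varsigma}(x,u))=0$; $D_{\alpha,\beta,\gamma\varsigma}(x,y,\rho_{\gamma,\varsigma}(z,u))-\rho_{\gamma,\alpha\beta\varsigma}(z,D_{\alpha,\beta,\varsigma}(x,y,u))-\rho_{\alpha\beta\gamma,\varsigma}(\{x,y,z\}_{\alpha,\beta,\gamma},u)=0$; $\theta_{\alpha,\beta\gamma,\varsigma}(x,[y,z]_{\beta,\gamma},u)-\rho_{\beta,\alpha\gamma\varsigma}(y,\theta_{\alpha,\gamma,\varsigma}(x,z,u))+\rho_{\gamma,\alpha\beta\varsigma}(z,\theta_{\alpha,\beta,\varsigma}(x,y,u))=0$; $D_{\tau,\alpha,\beta\gamma\varsigma}(a,x,\theta_{\beta,\gamma,\varsigma}(y,z,u))-\theta_{\beta,\gamma,\tau\alpha\varsigma}(y,z,D_{\tau,\alpha,\varsigma}(a,x,u))-\theta_{\tau\alpha\beta,\gamma,\varsigma}(\{a,x,y\}_{\tau,\alpha,\beta},z,u)-\theta_{\beta,\tau\alpha\gamma,\varsigma}(y,\{a,x,z\}_{\tau,\alpha,\gamma},u)=0$; $\theta_{\tau,\alpha\beta\gamma,\varsigma}(a,\{x,y,z\}_{\alpha,\beta,\gamma},u)-\theta_{\beta,\gamma,\tau\alpha\varsigma}(y,z,\theta_{\tau,\alpha,\varsigma}(a,x,u))+\theta_{\alpha,\gamma,\tau\beta\varsigma}(x,z,\theta_{\tau,\beta,\varsigma}(a,y,u))-D_{\alpha,\beta,\tau\gamma\varsigma}(x,y,\theta_{\tau,\gamma,\varsigma}(a,z,u))=0$.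 *)

theory Defs
  imports "HOL-Computational_Algebra.Computational_Algebra"
begin

text \<open>
  A vector space is a type of class \<open>ab_group_add\<close> together with a scalar multiplication
  satisfying the locale \<open>vector_space\<close>. Elements of \<open>End(V)\<close> appear as curried functions:
  \<open>\<rho> x v\<close> is \<open>\<rho>(x)v\<close> and \<open>\<theta> x y v\<close> is \<open>\<theta>(x,y)v\<close>; linearity of \<open>\<rho> : L \<rightarrow> End(V)\<close> together
  with linearity of each \<open>\<rho>(x)\<close> is bilinearity of the curried function, and likewise for \<open>\<theta>\<close>.
\<close>

definition bilinear_map ::
  "('k::field \<Rightarrow> 'a::ab_group_add \<Rightarrow> 'a) \<Rightarrow> ('k \<Rightarrow> 'b::ab_group_add \<Rightarrow> 'b) \<Rightarrow>
   ('k \<Rightarrow> 'c::ab_group_add \<Rightarrow> 'c) \<Rightarrow> ('a \<Rightarrow> 'b \<Rightarrow> 'c) \<Rightarrow> bool" where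
  "bilinear_map sA sB sC f \<longleftrightarrow>
     (\<forall>y. Vector_Spaces.linear sA sC (\<lambda>x. f x y)) \<and>
     (\<forall>x. Vector_Spaces.linear sB sC (\<lambda>y. f x y))"

definition trilinear_map ::
  "('k::field \<Rightarrow> 'a::ab_group_add \<Rightarrow> 'a) \<Rightarrow> ('k \<Rightarrow> 'b::ab_group_add \<Rightarrow> 'b) \<Rightarrow>
   ('k \<Rightarrow> 'c::ab_group_add \<Rightarrow> 'c) \<Rightarrow> ('k \<Rightarrow> 'd::ab_group_add \<Rightarrow> 'd) \<Rightarrow>
   ('a \<Rightarrow> 'b \<Rightarrow> 'c \<Rightarrow> 'd) \<Rightarrow> bool" where
  "trilinear_map sA sB sC sD f \<longleftrightarrow>
     (\<forall>y z. Vector_Spaces.linear sA sD (\<lambda>x. f x y z)) \<and>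
     (\<forall>x z. Vector_Spaces.linear sB sD (\<lambda>y. f x y z)) \<and>
     (\<forall>x y. Vector_Spaces.linear sC sD (\<lambda>z. f x y z))"

text \<open>
  Linear maps out of \<open>\<wedge>\<^sup>2L\<close> and \<open>\<wedge>\<^sup>2L \<otimes> L\<close> are bilinear and trilinear maps vanishing when
  the first two arguments coincide; away from characteristic 2 this is skew-symmetry.
\<close>

definition hom_wedge2 ::
  "('k::field \<Rightarrow> 'a::ab_group_add \<Rightarrow> 'a) \<Rightarrow> ('k \<Rightarrow> 'b::ab_group_add \<Rightarrow> 'b) \<Rightarrow>
   ('a \<Rightarrow> 'a \<Rightarrow> 'b) set" where
  "hom_wedge2 sA sB = {f. bilinear_map sA sA sB f \<and> (\<forall>x. f x x = 0)}"

definition hom_wedge2_tensor ::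
  "('k::field \<Rightarrow> 'a::ab_group_add \<Rightarrow> 'a) \<Rightarrow> ('k \<Rightarrow> 'b::ab_group_add \<Rightarrow> 'b) \<Rightarrow>
   ('a \<Rightarrow> 'a \<Rightarrow> 'a \<Rightarrow> 'b) set" where
  "hom_wedge2_tensor sA sB = {f. trilinear_map sA sA sA sB f \<and> (\<forall>x z. f x x z = 0)}"

locale lie_yamaguti_algebra = vector_space sL
  for sL :: "'k::field \<Rightarrow> 'l::ab_group_add \<Rightarrow> 'l" +
  fixes br :: "'l \<Rightarrow> 'l \<Rightarrow> 'l"
    and tr :: "'l \<Rightarrow> 'l \<Rightarrow> 'l \<Rightarrow> 'l"
  assumes br_hom: "br \<in> hom_wedge2 sL sL"
    and tr_hom: "tr \<in> hom_wedge2_tensor sL sL"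
    and ly1: "br (br x y) z + br (br y z) x + br (br z x) y
              + tr x y z + tr z x y + tr y z x = 0"
    and ly2: "tr (br x y) z a + tr (br y z) x a + tr (br z x) y a = 0"
    and ly3: "tr a b (br x y) = br (tr a b x) y + br x (tr a b y)"
    and ly4: "tr a b (tr x y z) = tr (tr a b x) y z + tr x (tr a b y) z + tr x y (tr a b z)"

definition ly_D ::
  "('l \<Rightarrow> 'l \<Rightarrow> 'l) \<Rightarrow> ('l \<Rightarrow> 'v::ab_group_add \<Rightarrow> 'v) \<Rightarrow> ('l \<Rightarrow> 'l \<Rightarrow> 'v \<Rightarrow> 'v) \<Rightarrow>
   'l \<Rightarrow> 'l \<Rightarrow> 'v \<Rightarrow> 'v" where
  "ly_D br \<rho> \<theta> x y v = \<theta> y x v - \<theta> x y v - \<rho> (br x y) v + \<rho> x (\<rho> y v) - \<rho> y (\<rho> x v)"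

locale ly_representation =
  lie_yamaguti_algebra sL br tr + V: vector_space sV
  for sL :: "'k::field \<Rightarrow> 'l::ab_group_add \<Rightarrow> 'l"
    and br :: "'l \<Rightarrow> 'l \<Rightarrow> 'l"
    and tr :: "'l \<Rightarrow> 'l \<Rightarrow> 'l \<Rightarrow> 'l"
    and sV :: "'k \<Rightarrow> 'v::ab_group_add \<Rightarrow> 'v" +
  fixes \<rho> :: "'l \<Rightarrow> 'v \<Rightarrow> 'v"
    and \<theta> :: "'l \<Rightarrow> 'l \<Rightarrow> 'v \<Rightarrow> 'v"
  assumes rho_bilinear: "bilinear_map sL sV sV \<rho>"
    and theta_trilinear: "trilinear_map sL sL sV sV \<theta>"
    and rep1: "\<theta> (br x y) z v - \<theta> x z (\<rho> y v) + \<theta> y z (\<rho> x v) = 0"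
    and rep2: "ly_D br \<rho> \<theta> x y (\<rho> z v) - \<rho> z (ly_D br \<rho> \<theta> x y v) - \<rho> (tr x y z) v = 0"
    and rep3: "\<theta> x (br y z) v - \<rho> y (\<theta> x z v) + \<rho> z (\<theta> x y v) = 0"
    and rep4: "ly_D br \<rho> \<theta> a b (\<theta> x y v) - \<theta> x y (ly_D br \<rho> \<theta> a b v)
               - \<theta> (tr a b x) y v - \<theta> x (tr a b y) v = 0"
    and rep5: "\<theta> a (tr x y z) v - \<theta> y z (\<theta> a x v) + \<theta> x z (\<theta> a y v)
               - ly_D br \<rho> \<theta> x y (\<theta> a z v) = 0"

definition cocycles23 ::
  "('k::field \<Rightarrow> 'l::ab_group_add \<Rightarrow> 'l) \<Rightarrow> ('l \<Rightarrow> 'l \<Rightarrow> 'l) \<Rightarrow> ('l \<Rightarrow> 'l \<Rightarrow> 'l \<Rightarrow> 'l) \<Rightarrow>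
   ('k \<Rightarrow> 'v::ab_group_add \<Rightarrow> 'v) \<Rightarrow> ('l \<Rightarrow> 'v \<Rightarrow> 'v) \<Rightarrow> ('l \<Rightarrow> 'l \<Rightarrow> 'v \<Rightarrow> 'v) \<Rightarrow>
   (('l \<Rightarrow> 'l \<Rightarrow> 'v) \<times> ('l \<Rightarrow> 'l \<Rightarrow> 'l \<Rightarrow> 'v)) set" where
  "cocycles23 sL br tr sV \<rho> \<theta> = {(\<Gamma>1, \<Gamma>2).
     \<Gamma>1 \<in> hom_wedge2 sL sV \<and> \<Gamma>2 \<in> hom_wedge2_tensor sL sV \<and>
     (\<forall>x1 y1 z.
        - \<rho> x1 (\<Gamma>1 y1 z) - \<rho> y1 (\<Gamma>1 z x1) - \<rho> z (\<Gamma>1 x1 y1)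
        + \<Gamma>1 (br x1 y1) z + \<Gamma>1 (br y1 z) x1 + \<Gamma>1 (br z x1) y1
        + \<Gamma>2 x1 y1 z + \<Gamma>2 y1 z x1 + \<Gamma>2 z x1 y1 = 0) \<and>
     (\<forall>x1 y1 x2 y2.
        \<theta> x1 y2 (\<Gamma>1 y1 x2) + \<theta> y1 y2 (\<Gamma>1 x2 x1) + \<theta> x2 y2 (\<Gamma>1 x1 y1)
        + \<Gamma>2 (br x1 y1) x2 y2 + \<Gamma>2 (br y1 x2) x1 y2 + \<Gamma>2 (br x2 x1) y1 y2 = 0) \<and>
     (\<forall>x1 y1 x2 y2.
        - \<rho> x2 (\<Gamma>2 x1 y1 y2) + \<rho> y2 (\<Gamma>2 x1 y1 x2) + \<Gamma>2 x1 y1 (br x2 y2)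
        + ly_D br \<rho> \<theta> x1 y1 (\<Gamma>1 x2 y2)
        - \<Gamma>1 (tr x1 y1 x2) y2 - \<Gamma>1 x2 (tr x1 y1 y2) = 0) \<and>
     (\<forall>x1 y1 x2 y2 z.
        - \<theta> y2 z (\<Gamma>2 x1 y1 x2) + \<theta> x2 z (\<Gamma>2 x1 y1 y2)
        + ly_D br \<rho> \<theta> x1 y1 (\<Gamma>2 x2 y2 z) - ly_D br \<rho> \<theta> x2 y2 (\<Gamma>2 x1 y1 z)
        - \<Gamma>2 (tr x1 y1 x2) y2 z - \<Gamma>2 x2 (tr x1 y1 y2) z
        + \<Gamma>2 x1 y1 (tr x2 y2 z) - \<Gamma>2 x2 y2 (tr x1 y1 z) = 0)}"

definition twisted_rota_baxter_family ::
  "('k::field \<Rightarrow> 'l::ab_group_add \<Rightarrow> 'l) \<Rightarrow> ('l \<Rightarrow> 'l \<Rightarrow> 'l) \<Rightarrow> ('l \<Rightarrow> 'l \<Rightarrow> 'l \<Rightarrow> 'l) \<Rightarrow>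
   ('k \<Rightarrow> 'v::ab_group_add \<Rightarrow> 'v) \<Rightarrow> ('l \<Rightarrow> 'v \<Rightarrow> 'v) \<Rightarrow> ('l \<Rightarrow> 'l \<Rightarrow> 'v \<Rightarrow> 'v) \<Rightarrow>
   ('l \<Rightarrow> 'l \<Rightarrow> 'v) \<times> ('l \<Rightarrow> 'l \<Rightarrow> 'l \<Rightarrow> 'v) \<Rightarrow>
   ('w::ab_semigroup_mult \<Rightarrow> 'v \<Rightarrow> 'l) \<Rightarrow> bool" where
  "twisted_rota_baxter_family sL br tr sV \<rho> \<theta> = (\<lambda>(\<Gamma>1, \<Gamma>2) T.
     (\<forall>\<alpha>. Vector_Spaces.linear sV sL (T \<alpha>)) \<and>
     (\<forall>\<alpha> \<beta> u v.
        br (T \<alpha> u) (T \<beta> v) =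
          T (\<alpha> * \<beta>) (\<rho> (T \<alpha> u) v - \<rho> (T \<beta> v) u + \<Gamma>1 (T \<alpha> u) (T \<beta> v))) \<and>
     (\<forall>\<alpha> \<beta> \<gamma> u v w.
        tr (T \<alpha> u) (T \<beta> v) (T \<gamma> w) =
          T (\<alpha> * \<beta> * \<gamma>) (ly_D br \<rho> \<theta> (T \<alpha> u) (T \<beta> v) w - \<theta> (T \<alpha> u) (T \<gamma> w) v
            + \<theta> (T \<beta> v) (T \<gamma> w) u + \<Gamma>2 (T \<alpha> u) (T \<beta> v) (T \<gamma> w))))"

locale omega_lie_yamaguti_algebra = vector_space sA
  for sA :: "'k::field \<Rightarrow> 'a::ab_group_add \<Rightarrow> 'a" +
  fixes br :: "'w::ab_semigroup_mult \<Rightarrow> 'w \<Rightarrow> 'a \<Rightarrow> 'a \<Rightarrow> 'a"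
    and tr :: "'w \<Rightarrow> 'w \<Rightarrow> 'w \<Rightarrow> 'a \<Rightarrow> 'a \<Rightarrow> 'a \<Rightarrow> 'a"
  assumes br_bilinear: "bilinear_map sA sA sA (br \<alpha> \<beta>)"
    and tr_trilinear: "trilinear_map sA sA sA sA (tr \<alpha> \<beta> \<gamma>)"
    and br_skew: "br \<alpha> \<beta> x y = - br \<beta> \<alpha> y x"
    and tr_skew: "tr \<alpha> \<beta> \<gamma> x y z = - tr \<beta> \<alpha> \<gamma> y x z"
    and oly1:
      "br (\<alpha> * \<beta>) \<gamma> (br \<alpha> \<beta> x y) z + br (\<beta> * \<gamma>) \<alpha> (br \<beta> \<gamma> y z) x
       + br (\<gamma> * \<alpha>) \<beta> (br \<gamma> \<alpha> z x) y
       + tr \<alpha> \<beta> \<gamma> x y z + tr \<beta> \<gamma> \<alpha> y z x + tr \<gamma> \<alpha> \<beta> z x y = 0"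
    and oly2:
      "tr (\<alpha> * \<beta>) \<gamma> \<sigma> (br \<alpha> \<beta> x y) z a + tr (\<beta> * \<gamma>) \<alpha> \<sigma> (br \<beta> \<gamma> y z) x a
       + tr (\<gamma> * \<alpha>) \<beta> \<sigma> (br \<gamma> \<alpha> z x) y a = 0"
    and oly3:
      "tr \<sigma> \<alpha> (\<beta> * \<gamma>) a x (br \<beta> \<gamma> y z) =
         br (\<sigma> * \<alpha> * \<beta>) \<gamma> (tr \<sigma> \<alpha> \<beta> a x y) z + br \<beta> (\<sigma> * \<alpha> * \<gamma>) y (tr \<sigma> \<alpha> \<gamma> a x z)"
    and oly4:
      "tr \<sigma> \<tau> (\<alpha> * \<beta> * \<gamma>) a b (tr \<alpha> \<beta> \<gamma> x y z) =
         tr (\<sigma> * \<tau> * \<alpha>) \<beta> \<gamma> (tr \<sigma> \<tau> \<alpha> a b x) y z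
         + tr \<alpha> (\<sigma> * \<tau> * \<beta>) \<gamma> x (tr \<sigma> \<tau> \<beta> a b y) z
         + tr \<alpha> \<beta> (\<sigma> * \<tau> * \<gamma>) x y (tr \<sigma> \<tau> \<gamma> a b z)"

definition omega_D ::
  "('w::ab_semigroup_mult \<Rightarrow> 'w \<Rightarrow> 'a \<Rightarrow> 'a \<Rightarrow> 'a) \<Rightarrow>
   ('w \<Rightarrow> 'w \<Rightarrow> 'a \<Rightarrow> 'm::ab_group_add \<Rightarrow> 'm) \<Rightarrow>
   ('w \<Rightarrow> 'w \<Rightarrow> 'w \<Rightarrow> 'a \<Rightarrow> 'a \<Rightarrow> 'm \<Rightarrow> 'm) \<Rightarrow>
   'w \<Rightarrow> 'w \<Rightarrow> 'w \<Rightarrow> 'a \<Rightarrow> 'a \<Rightarrow> 'm \<Rightarrow> 'm" where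
  "omega_D br \<rho> \<theta> \<alpha> \<beta> \<sigma> x y u =
     \<theta> \<beta> \<alpha> \<sigma> y x u - \<theta> \<alpha> \<beta> \<sigma> x y u - \<rho> (\<alpha> * \<beta>) \<sigma> (br \<alpha> \<beta> x y) u
     + \<rho> \<alpha> (\<beta> * \<sigma>) x (\<rho> \<beta> \<sigma> y u) - \<rho> \<beta> (\<alpha> * \<sigma>) y (\<rho> \<alpha> \<sigma> x u)"

locale omega_ly_representation =
  omega_lie_yamaguti_algebra sA br tr + W: vector_space sW
  for sA :: "'k::field \<Rightarrow> 'a::ab_group_add \<Rightarrow> 'a"
    and br :: "'w::ab_semigroup_mult \<Rightarrow> 'w \<Rightarrow> 'a \<Rightarrow> 'a \<Rightarrow> 'a"
    and tr :: "'w \<Rightarrow> 'w \<Rightarrow> 'w \<Rightarrow> 'a \<Rightarrow> 'a \<Rightarrow> 'a \<Rightarrow> 'a"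
    and sW :: "'k \<Rightarrow> 'm::ab_group_add \<Rightarrow> 'm" +
  fixes \<rho> :: "'w \<Rightarrow> 'w \<Rightarrow> 'a \<Rightarrow> 'm \<Rightarrow> 'm"
    and \<theta> :: "'w \<Rightarrow> 'w \<Rightarrow> 'w \<Rightarrow> 'a \<Rightarrow> 'a \<Rightarrow> 'm \<Rightarrow> 'm"
  assumes rho_bilinear: "bilinear_map sA sW sW (\<rho> \<alpha> \<sigma>)"
    and theta_trilinear: "trilinear_map sA sA sW sW (\<theta> \<alpha> \<beta> \<sigma>)"
    and orep1:
      "\<theta> (\<alpha> * \<beta>) \<gamma> \<sigma> (br \<alpha> \<beta> x y) z u - \<theta> \<alpha> \<gamma> (\<beta> * \<sigma>) x z (\<rho> \<beta> \<sigma> y u)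
       + \<theta> \<beta> \<gamma> (\<alpha> * \<sigma>) y z (\<rho> \<alpha> \<sigma> x u) = 0"
    and orep2:
      "omega_D br \<rho> \<theta> \<alpha> \<beta> (\<gamma> * \<sigma>) x y (\<rho> \<gamma> \<sigma> z u)
       - \<rho> \<gamma> (\<alpha> * \<beta> * \<sigma>) z (omega_D br \<rho> \<theta> \<alpha> \<beta> \<sigma> x y u)
       - \<rho> (\<alpha> * \<beta> * \<gamma>) \<sigma> (tr \<alpha> \<beta> \<gamma> x y z) u = 0"
    and orep3:
      "\<theta> \<alpha> (\<beta> * \<gamma>) \<sigma> x (br \<beta> \<gamma> y z) u - \<rho> \<beta> (\<alpha> * \<gamma> * \<sigma>) y (\<theta> \<alpha> \<gamma> \<sigma> x z u)
       + \<rho> \<gamma> (\<alpha> * \<beta> * \<sigma>) z (\<theta> \<alpha> \<beta> \<sigma> x y u) = 0"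
    and orep4:
      "omega_D br \<rho> \<theta> \<tau> \<alpha> (\<beta> * \<gamma> * \<sigma>) a x (\<theta> \<beta> \<gamma> \<sigma> y z u)
       - \<theta> \<beta> \<gamma> (\<tau> * \<alpha> * \<sigma>) y z (omega_D br \<rho> \<theta> \<tau> \<alpha> \<sigma> a x u)
       - \<theta> (\<tau> * \<alpha> * \<beta>) \<gamma> \<sigma> (tr \<tau> \<alpha> \<beta> a x y) z u
       - \<theta> \<beta> (\<tau> * \<alpha> * \<gamma>) \<sigma> y (tr \<tau> \<alpha> \<gamma> a x z) u = 0"
    and orep5:
      "\<theta> \<tau> (\<alpha> * \<beta> * \<gamma>) \<sigma> a (tr \<alpha> \<beta> \<gamma> x y z) u
       - \<theta> \<beta> \<gamma> (\<tau> * \<alpha> * \<sigma>) y z (\<theta> \<tau> \<alpha> \<sigma> a x u)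
       + \<theta> \<alpha> \<gamma> (\<tau> * \<beta> * \<sigma>) x z (\<theta> \<tau> \<beta> \<sigma> a y u)
       - omega_D br \<rho> \<theta> \<alpha> \<beta> (\<tau> * \<gamma> * \<sigma>) x y (\<theta> \<tau> \<gamma> \<sigma> a z u) = 0"

end

theory Submission
  imports Defs "HOL-Library.Product_Plus"
begin

text \<open>
  Let \<open>E = L \<oplus> V\<close> be the abelian extension of \<open>L\<close> by \<open>V\<close> determined by \<open>\<Gamma>\<close>.
  The twisted Rota-Baxter identities say exactly that the graphs
  \<open>G\<^sub>\<alpha> = {(T\<^sub>\<alpha> u, u)}\<close> satisfy \<open>[G\<^sub>\<alpha>, G\<^sub>\<beta>] \<subseteq> G\<^bsub>\<alpha>\<beta>\<^esub>\<close> and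
  \<open>{G\<^sub>\<alpha>, G\<^sub>\<beta>, G\<^sub>\<gamma>} \<subseteq> G\<^bsub>\<alpha>\<beta>\<gamma>\<^esub>\<close>. Hence the graphs act on the quotients
  \<open>E / G\<^sub>\<sigma>\<close> by the adjoint action, and \<open>(x, u) \<mapsto> x - T\<^sub>\<sigma> u\<close> identifies each
  quotient with \<open>L\<close>. All identities of the representation are then images of the
  Lie-Yamaguti identities of \<open>E\<close>.
\<close>

section \<open>Rules for linear and multilinear maps, and skew-symmetry from alternation\<close>

lemma linear_simps:
  assumes "Vector_Spaces.linear s t f"
  shows "f (x + y) = f x + f y" "f (x - y) = f x - f y" "f (- x) = - f x" "f 0 = 0"
proof -
  interpret Vector_Spaces.linear s t f by (rule assms)
  show "f (x + y) = f x + f y" "f (x - y) = f x - f y" "f (- x) = - f x" "f 0 = 0"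
    by (rule add diff neg zero)+
qed

lemma linear_compose:
  assumes "Vector_Spaces.linear s t f" "Vector_Spaces.linear t r g"
  shows "Vector_Spaces.linear s r (\<lambda>x. g (f x))"
  using Vector_Spaces.linear_compose[OF assms] by (simp add: comp_def)

lemma bilinear_map_simps:
  assumes "bilinear_map sA sB sC f"
  shows "f (x + y) z = f x z + f y z" "f (x - y) z = f x z - f y z"
    "f (- x) z = - f x z" "f 0 z = 0"
    "f u (v + w) = f u v + f u w" "f u (v - w) = f u v - f u w"
    "f u (- v) = - f u v" "f u 0 = 0"
proof -
  have 1: "Vector_Spaces.linear sA sC (\<lambda>x. f x z)" and 2: "Vector_Spaces.linear sB sC (f u)"
    using assms by (auto simp: bilinear_map_def)
  show "f (x + y) z = f x z + f y z" "f (x - y) z = f x z - f y z"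
    "f (- x) z = - f x z" "f 0 z = 0"
    using linear_simps[OF 1] by auto
  show "f u (v + w) = f u v + f u w" "f u (v - w) = f u v - f u w"
    "f u (- v) = - f u v" "f u 0 = 0"
    using linear_simps[OF 2] by auto
qed

lemma trilinear_map_simps:
  assumes "trilinear_map sA sB sC sD f"
  shows "f (x + x') y z = f x y z + f x' y z" "f (x - x') y z = f x y z - f x' y z"
    "f (- x) y z = - f x y z" "f 0 y z = 0"
    "f x (y + y') z = f x y z + f x y' z" "f x (y - y') z = f x y z - f x y' z"
    "f x (- y) z = - f x y z" "f x 0 z = 0"
    "f x y (z + z') = f x y z + f x y z'" "f x y (z - z') = f x y z - f x y z'"
    "f x y (- z) = - f x y z" "f x y 0 = 0"
proof -
  have 1: "Vector_Spaces.linear sA sD (\<lambda>x. f x y z)"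
    and 2: "Vector_Spaces.linear sB sD (\<lambda>y. f x y z)"
    and 3: "Vector_Spaces.linear sC sD (f x y)"
    using assms by (auto simp: trilinear_map_def)
  show "f (x + x') y z = f x y z + f x' y z" "f (x - x') y z = f x y z - f x' y z"
    "f (- x) y z = - f x y z" "f 0 y z = 0"
    using linear_simps[OF 1] by auto
  show "f x (y + y') z = f x y z + f x y' z" "f x (y - y') z = f x y z - f x y' z"
    "f x (- y) z = - f x y z" "f x 0 z = 0"
    using linear_simps[OF 2] by auto
  show "f x y (z + z') = f x y z + f x y z'" "f x y (z - z') = f x y z - f x y z'"
    "f x y (- z) = - f x y z" "f x y 0 = 0"
    using linear_simps[OF 3] by auto
qed

lemma bilinear_map_compose:
  assumes "bilinear_map sA sB sC f" "Vector_Spaces.linear sX sA a"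
    "Vector_Spaces.linear sY sB b" "Vector_Spaces.linear sC sZ c"
  shows "bilinear_map sX sY sZ (\<lambda>x y. c (f (a x) (b y)))"
  using assms(1) unfolding bilinear_map_def
  by (auto intro!: linear_compose[OF _ assms(4)]
      intro: linear_compose[OF assms(2)] linear_compose[OF assms(3)])

lemma trilinear_map_compose:
  assumes f: "trilinear_map sA sB sC sD f" and "Vector_Spaces.linear sX sA a"
    "Vector_Spaces.linear sY sB b" "Vector_Spaces.linear sZ sC c" "Vector_Spaces.linear sD sW d"
  shows "trilinear_map sX sY sZ sW (\<lambda>x y z. d (f (a x) (b y) (c z)))"
proof -
  have 1: "Vector_Spaces.linear sA sD (\<lambda>x. f x y z)"
    and 2: "Vector_Spaces.linear sB sD (\<lambda>y. f x y z)"
    and 3: "Vector_Spaces.linear sC sD (\<lambda>z. f x y z)" for x y z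
    using f by (auto simp: trilinear_map_def)
  show ?thesis
    unfolding trilinear_map_def
    using linear_compose[OF linear_compose[OF assms(2) 1] assms(5)]
      linear_compose[OF linear_compose[OF assms(3) 2] assms(5)]
      linear_compose[OF linear_compose[OF assms(4) 3] assms(5)]
    by blast
qed

text \<open>Polarization: expanding \<open>f (x + y) (x + y) = 0\<close> leaves only the two mixed
  terms. This turns the vanishing conditions in \<open>hom_wedge2\<close> and
  \<open>hom_wedge2_tensor\<close> into sign rules for rewriting.\<close>

lemma alternating_skew:
  fixes f :: "'a::ab_group_add \<Rightarrow> 'a \<Rightarrow> 'b::ab_group_add"
  assumes "\<And>x y z. f (x + y) z = f x z + f y z" "\<And>x y z. f x (y + z) = f x y + f x z"
    and "\<And>x. f x x = 0"
  shows "f x y = - f y x"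
proof -
  have "0 = f (x + y) (x + y)" by (simp add: assms(3))
  also have "\<dots> = f x y + f y x" by (simp only: assms(1,2)) (simp add: assms(3))
  finally show ?thesis by (simp add: eq_neg_iff_add_eq_0)
qed

lemma hom_wedge2_skew: "f \<in> hom_wedge2 sA sB \<Longrightarrow> f x y = - f y x"
  by (rule alternating_skew) (auto simp: hom_wedge2_def bilinear_map_simps)

lemma hom_wedge2_tensor_skew: "f \<in> hom_wedge2_tensor sA sB \<Longrightarrow> f x y z = - f y x z"
  by (rule alternating_skew[where f = "\<lambda>x y. f x y z" for z])
    (auto simp: hom_wedge2_tensor_def trilinear_map_simps)

context lie_yamaguti_algebra
begin

lemma br_bilinear: "bilinear_map sL sL sL br" and tr_trilinear: "trilinear_map sL sL sL sL tr"
  using br_hom tr_hom by (auto simp: hom_wedge2_def hom_wedge2_tensor_def)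

lemmas br_simps = bilinear_map_simps[OF br_bilinear]
lemmas tr_simps = trilinear_map_simps[OF tr_trilinear]
lemmas br_skew = hom_wedge2_skew[OF br_hom]
lemmas tr_skew = hom_wedge2_tensor_skew[OF tr_hom]

end

section \<open>Induced operations on a graded family of subspaces and on its quotients\<close>

text \<open>
  \<open>G\<close>, \<open>P\<close> form an \<open>\<Omega>\<close>-indexed family of exact sequences
  \<open>0 \<rightarrow> A \<rightarrow> E \<rightarrow> W \<rightarrow> 0\<close>, with retraction \<open>q\<close> and section \<open>j\<close> independent of the index.
\<close>

locale split_graded_subalgebra =
  lie_yamaguti_algebra sE br tr + A: vector_space sA + W: vector_space sW
  for sE :: "'k::field \<Rightarrow> 'e::ab_group_add \<Rightarrow> 'e"
    and br :: "'e \<Rightarrow> 'e \<Rightarrow> 'e"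
    and tr :: "'e \<Rightarrow> 'e \<Rightarrow> 'e \<Rightarrow> 'e"
    and sA :: "'k \<Rightarrow> 'a::ab_group_add \<Rightarrow> 'a"
    and sW :: "'k \<Rightarrow> 'm::ab_group_add \<Rightarrow> 'm" +
  fixes G :: "'w::ab_semigroup_mult \<Rightarrow> 'a \<Rightarrow> 'e" and q :: "'e \<Rightarrow> 'a"
    and P :: "'w \<Rightarrow> 'e \<Rightarrow> 'm" and j :: "'m \<Rightarrow> 'e"
  assumes G_linear: "Vector_Spaces.linear sA sE (G \<alpha>)"
    and q_linear: "Vector_Spaces.linear sE sA q"
    and P_linear: "Vector_Spaces.linear sE sW (P \<alpha>)"
    and j_linear: "Vector_Spaces.linear sW sE j"
    and q_G: "q (G \<alpha> u) = u"
    and P_j: "P \<alpha> (j w) = w"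
    and P_eq_0_iff: "P \<alpha> e = 0 \<longleftrightarrow> e \<in> range (G \<alpha>)"
    and br_closed: "br (G \<alpha> u) (G \<beta> v) \<in> range (G (\<alpha> * \<beta>))"
    and tr_closed: "tr (G \<alpha> u) (G \<beta> v) (G \<gamma> z) \<in> range (G (\<alpha> * \<beta> * \<gamma>))"
begin

definition "brA \<alpha> \<beta> u v = q (br (G \<alpha> u) (G \<beta> v))"
definition "trA \<alpha> \<beta> \<gamma> u v w = q (tr (G \<alpha> u) (G \<beta> v) (G \<gamma> w))"
text \<open>\<open>P \<sigma>\<close> identifies \<open>E / G \<sigma>\<close> with
  \<open>W\<close>, and \<open>j x\<close> is a chosen representative of the class \<open>x\<close>.
  The outer index of \<open>P\<close> records the quotient in which the product lands. Keeping the
  fixed \<open>j\<close> in the body makes linearity immediate and yields closed formulas once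
  \<open>E\<close> is specialized.\<close>

definition "rhoW \<alpha> \<sigma> u x = P (\<sigma> * \<alpha>) (br (G \<alpha> u) (j x))"
definition "thetaW \<alpha> \<beta> \<sigma> u v x = P (\<sigma> * \<alpha> * \<beta>) (tr (j x) (G \<alpha> u) (G \<beta> v))"

lemmas q_simps = linear_simps[OF q_linear]
lemmas P_simps = linear_simps[OF P_linear]

text \<open>By closure the bracket lies in the image of \<open>G (\<alpha> * \<beta>)\<close>, where
  \<open>q\<close> inverts \<open>G\<close>. Thus \<open>G\<close> carries \<open>brA\<close> to the
  bracket of \<open>E\<close>, which lets nested operations be evaluated in
  \<open>E\<close>.\<close>

lemma G_brA: "G (\<alpha> * \<beta>) (brA \<alpha> \<beta> u v) = br (G \<alpha> u) (G \<beta> v)"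
  using br_closed[of \<alpha> u \<beta> v] by (auto simp: brA_def q_G)

lemma G_trA: "G (\<alpha> * \<beta> * \<gamma>) (trA \<alpha> \<beta> \<gamma> u v w) = tr (G \<alpha> u) (G \<beta> v) (G \<gamma> w)"
  using tr_closed[of \<alpha> u \<beta> v \<gamma> w] by (auto simp: trA_def q_G)

lemma P_surj: obtains e where "x = P \<sigma> e"
  using P_j by metis

text \<open>\<open>e\<close> and \<open>j (P \<sigma> e)\<close> have the same image under
  \<open>P \<sigma>\<close>, so they differ by an element of its kernel, the image of
  \<open>G \<sigma>\<close>.\<close>

lemma section_P: obtains z where "j (P \<sigma> e) = e - G \<sigma> z"
proof -
  have "P \<sigma> (e - j (P \<sigma> e)) = 0" by (simp add: P_simps P_j)
  then obtain z where "e - j (P \<sigma> e) = G \<sigma> z" by (auto simp: P_eq_0_iff)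
  then show thesis by (intro that[of z]) (simp add: algebra_simps)
qed

text \<open>The closure conditions make the brackets with \<open>G \<alpha> u\<close> descend to \<open>E / G \<sigma>\<close>, so \<open>j\<close> disappears.\<close>

lemma rhoW_P: "rhoW \<alpha> \<sigma> u (P \<sigma> e) = P (\<sigma> * \<alpha>) (br (G \<alpha> u) e)"
proof -
  obtain z where z: "j (P \<sigma> e) = e - G \<sigma> z" by (rule section_P)
  \<comment> \<open>\<open>br_closed\<close> yields the index \<open>\<alpha> * \<sigma>\<close>,
    while \<open>rhoW\<close> projects with \<open>\<sigma> * \<alpha>\<close>; commutativity of the
    index semigroup reconciles the two.\<close>
  have "P (\<sigma> * \<alpha>) (br (G \<alpha> u) (G \<sigma> z)) = 0"
    unfolding P_eq_0_iff using br_closed[of \<alpha> u \<sigma> z] by (simp add: mult.commute)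
  then show ?thesis by (simp add: rhoW_def z br_simps P_simps)
qed

lemma thetaW_P:
  "thetaW \<alpha> \<beta> \<sigma> u v (P \<sigma> e) = P (\<sigma> * \<alpha> * \<beta>) (tr e (G \<alpha> u) (G \<beta> v))"
proof -
  obtain z where z: "j (P \<sigma> e) = e - G \<sigma> z" by (rule section_P)
  have "P (\<sigma> * \<alpha> * \<beta>) (tr (G \<sigma> z) (G \<alpha> u) (G \<beta> v)) = 0"
    unfolding P_eq_0_iff by (rule tr_closed)
  then show ?thesis by (simp add: thetaW_def z tr_simps P_simps)
qed

text \<open>Solving \<open>ly1\<close> for \<open>tr x y e\<close> gives precisely the expression
  that defines \<open>omega_D\<close>, with the adjoint action in place of \<open>rhoW\<close> and
  \<open>thetaW\<close>. Hence \<open>omega_D\<close> is the action of \<open>tr x y\<close> on the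
  quotient.\<close>

lemma omega_D_P:
  "omega_D brA rhoW thetaW \<alpha> \<beta> \<sigma> u v (P \<sigma> e) = P (\<sigma> * \<alpha> * \<beta>) (tr (G \<alpha> u) (G \<beta> v) e)"
proof -
  define x y where "x = G \<alpha> u" and "y = G \<beta> v"
  have "br (br x y) e + br (br y e) x + br (br e x) y + tr x y e + tr e x y + tr y e x = 0"
    by (rule ly1)
  \<comment> \<open>Skew-symmetry brings every term of \<open>ly1\<close> to the shape used by
    \<open>omega_D\<close>: \<open>e\<close> in the last slot of a bracket and in the first slot of
    the \<open>thetaW\<close> terms.\<close>
  moreover have "br (br y e) x = - br x (br y e)" "br (br e x) y = br y (br x e)"
    "tr y e x = - tr e y x"
    using br_skew[of "br y e" x] br_skew[of e x] br_skew[of "br e x" y] tr_skew[of y e x]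
    by (simp_all add: br_simps)
  ultimately have "tr x y e = tr e y x - tr e x y - br (br x y) e + br x (br y e) - br y (br x e)"
    by (simp add: algebra_simps eq_neg_iff_add_eq_0)
  moreover have "rhoW \<alpha> (\<beta> * \<sigma>) u (rhoW \<beta> \<sigma> v (P \<sigma> e)) = P (\<sigma> * \<alpha> * \<beta>) (br x (br y e))"
    using rhoW_P[of \<alpha> "\<beta> * \<sigma>" u] by (simp add: rhoW_P x_def y_def ac_simps)
  moreover have "rhoW \<beta> (\<alpha> * \<sigma>) v (rhoW \<alpha> \<sigma> u (P \<sigma> e)) = P (\<sigma> * \<alpha> * \<beta>) (br y (br x e))"
    using rhoW_P[of \<beta> "\<alpha> * \<sigma>" v] by (simp add: rhoW_P x_def y_def ac_simps)
  moreover have "rhoW (\<alpha> * \<beta>) \<sigma> (brA \<alpha> \<beta> u v) (P \<sigma> e) = P (\<sigma> * \<alpha> * \<beta>) (br (br x y) e)"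
    by (simp add: rhoW_P G_brA x_def y_def ac_simps)
  ultimately show ?thesis
    by (simp add: omega_D_def thetaW_P P_simps x_def y_def ac_simps)
qed

text \<open>Each identity is \<open>q\<close> applied to the corresponding identity of
  \<open>E\<close>, evaluated on elements \<open>G \<alpha> x\<close>.\<close>

lemma omega_lie_yamaguti: "omega_lie_yamaguti_algebra sA brA trA"
proof
  fix \<alpha> \<beta> \<gamma> \<sigma> \<tau> :: 'w and x y z a b :: 'a
  show "bilinear_map sA sA sA (brA \<alpha> \<beta>)"
    unfolding brA_def[abs_def] by (rule bilinear_map_compose[OF br_bilinear G_linear G_linear q_linear])
  show "trilinear_map sA sA sA sA (trA \<alpha> \<beta> \<gamma>)"
    unfolding trA_def[abs_def]
    by (rule trilinear_map_compose[OF tr_trilinear G_linear G_linear G_linear q_linear])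
  show "brA \<alpha> \<beta> x y = - brA \<beta> \<alpha> y x"
    unfolding brA_def by (subst br_skew) (simp add: q_simps)
  show "trA \<alpha> \<beta> \<gamma> x y z = - trA \<beta> \<alpha> \<gamma> y x z"
    unfolding trA_def by (subst tr_skew) (simp add: q_simps)
  \<comment> \<open>Fixing the product index in the definition unfolds only the outer operation; the
    inner one then occurs under \<open>G\<close>, where \<open>G_brA\<close> removes it.\<close>
  have br2: "brA (\<alpha> * \<beta>) \<gamma> (brA \<alpha> \<beta> x y) z = q (br (br (G \<alpha> x) (G \<beta> y)) (G \<gamma> z))"
    for \<alpha> \<beta> \<gamma> x y z
    by (simp add: brA_def[of "\<alpha> * \<beta>"] G_brA)
  have trbr: "trA (\<alpha> * \<beta>) \<gamma> \<sigma> (brA \<alpha> \<beta> x y) z a = q (tr (br (G \<alpha> x) (G \<beta> y)) (G \<gamma> z) (G \<sigma> a))"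
    for \<alpha> \<beta> \<gamma> \<sigma> x y z a
    by (simp add: trA_def[of "\<alpha> * \<beta>"] G_brA)
  show "brA (\<alpha> * \<beta>) \<gamma> (brA \<alpha> \<beta> x y) z + brA (\<beta> * \<gamma>) \<alpha> (brA \<beta> \<gamma> y z) x
       + brA (\<gamma> * \<alpha>) \<beta> (brA \<gamma> \<alpha> z x) y
       + trA \<alpha> \<beta> \<gamma> x y z + trA \<beta> \<gamma> \<alpha> y z x + trA \<gamma> \<alpha> \<beta> z x y = 0"
    using arg_cong[OF ly1[of "G \<alpha> x" "G \<beta> y" "G \<gamma> z"], of q]
    by (simp add: br2 trA_def q_simps add_ac)
  show "trA (\<alpha> * \<beta>) \<gamma> \<sigma> (brA \<alpha> \<beta> x y) z a + trA (\<beta> * \<gamma>) \<alpha> \<sigma> (brA \<beta> \<gamma> y z) x a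
       + trA (\<gamma> * \<alpha>) \<beta> \<sigma> (brA \<gamma> \<alpha> z x) y a = 0"
    using arg_cong[OF ly2[of "G \<alpha> x" "G \<beta> y" "G \<gamma> z" "G \<sigma> a"], of q]
    by (simp add: trbr q_simps)
  show "trA \<sigma> \<alpha> (\<beta> * \<gamma>) a x (brA \<beta> \<gamma> y z) =
         brA (\<sigma> * \<alpha> * \<beta>) \<gamma> (trA \<sigma> \<alpha> \<beta> a x y) z + brA \<beta> (\<sigma> * \<alpha> * \<gamma>) y (trA \<sigma> \<alpha> \<gamma> a x z)"
    unfolding trA_def[of \<sigma> \<alpha> "\<beta> * \<gamma>"] brA_def[of "\<sigma> * \<alpha> * \<beta>"] brA_def[of \<beta> "\<sigma> * \<alpha> * \<gamma>"]
    by (simp only: G_brA G_trA ly3 q_simps)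
  show "trA \<sigma> \<tau> (\<alpha> * \<beta> * \<gamma>) a b (trA \<alpha> \<beta> \<gamma> x y z) =
         trA (\<sigma> * \<tau> * \<alpha>) \<beta> \<gamma> (trA \<sigma> \<tau> \<alpha> a b x) y z
         + trA \<alpha> (\<sigma> * \<tau> * \<beta>) \<gamma> x (trA \<sigma> \<tau> \<beta> a b y) z
         + trA \<alpha> \<beta> (\<sigma> * \<tau> * \<gamma>) x y (trA \<sigma> \<tau> \<gamma> a b z)"
    unfolding trA_def[of \<sigma> \<tau> "\<alpha> * \<beta> * \<gamma>"] trA_def[of "\<sigma> * \<tau> * \<alpha>"]
      trA_def[of \<alpha> "\<sigma> * \<tau> * \<beta>"] trA_def[of \<alpha> \<beta> "\<sigma> * \<tau> * \<gamma>"]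
    by (simp only: G_trA ly4[of "G \<sigma> a" "G \<tau> b"] q_simps)
qed

text \<open>With the module element written as the class of some \<open>e\<close>, all terms of an
  identity become classes in one common quotient. There the identity is a Lie-Yamaguti axiom of
  \<open>E\<close> with \<open>e\<close> as one of its arguments.\<close>

lemma omega_representation: "omega_ly_representation sA brA trA sW rhoW thetaW"
proof -
  interpret brA: omega_lie_yamaguti_algebra sA brA trA by (rule omega_lie_yamaguti)
  show ?thesis
  proof
    fix \<alpha> \<beta> \<gamma> \<sigma> \<tau> :: 'w and x y z a :: 'a and u :: 'm
    obtain e where u: "u = P \<sigma> e" by (rule P_surj)
    show "bilinear_map sA sW sW (rhoW \<alpha> \<sigma>)"
      unfolding rhoW_def[abs_def]
      by (rule bilinear_map_compose[OF br_bilinear G_linear j_linear P_linear])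
    \<comment> \<open>\<open>thetaW\<close> feeds its last argument into the first slot of
      \<open>tr\<close>, so trilinearity is first proved in the order used by \<open>tr\<close> and
      then permuted.\<close>
    have "trilinear_map sW sA sA sW (\<lambda>x u v. thetaW \<alpha> \<beta> \<sigma> u v x)"
      unfolding thetaW_def[abs_def]
      by (rule trilinear_map_compose[OF tr_trilinear j_linear G_linear G_linear P_linear])
    then show "trilinear_map sA sA sW sW (thetaW \<alpha> \<beta> \<sigma>)"
      by (auto simp: trilinear_map_def)
    \<comment> \<open>In these variants the indices enter as side conditions, so products bracketed
      or ordered differently are matched afterwards by associativity and commutativity.\<close>
    have rho: "rhoW \<alpha> \<sigma> x (P \<sigma>' e) = P \<delta> (br (G \<alpha> x) e)"
      if "\<sigma>' = \<sigma>" "\<delta> = \<sigma> * \<alpha>" for \<alpha> \<sigma> \<sigma>' \<delta> x e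
      using that by (simp add: rhoW_P)
    have theta: "thetaW \<alpha> \<beta> \<sigma> x y (P \<sigma>' e) = P \<delta> (tr e (G \<alpha> x) (G \<beta> y))"
      if "\<sigma>' = \<sigma>" "\<delta> = \<sigma> * \<alpha> * \<beta>" for \<alpha> \<beta> \<sigma> \<sigma>' \<delta> x y e
      using that by (simp add: thetaW_P)
    have D: "omega_D brA rhoW thetaW \<alpha> \<beta> \<sigma> x y (P \<sigma>' e) = P \<delta> (tr (G \<alpha> x) (G \<beta> y) e)"
      if "\<sigma>' = \<sigma>" "\<delta> = \<sigma> * \<alpha> * \<beta>" for \<alpha> \<beta> \<sigma> \<sigma>' \<delta> x y e
      using that by (simp add: omega_D_P)
    let ?a = "G \<tau> a"
    show "thetaW (\<alpha> * \<beta>) \<gamma> \<sigma> (brA \<alpha> \<beta> x y) z u - thetaW \<alpha> \<gamma> (\<beta> * \<sigma>) x z (rhoW \<beta> \<sigma> y u)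
       + thetaW \<beta> \<gamma> (\<alpha> * \<sigma>) y z (rhoW \<alpha> \<sigma> x u) = 0"
    proof -
      define \<delta> where "\<delta> = \<alpha> * \<beta> * \<gamma> * \<sigma>"
      let ?x = "G \<alpha> x" and ?y = "G \<beta> y" and ?z = "G \<gamma> z"
      have "thetaW (\<alpha> * \<beta>) \<gamma> \<sigma> (brA \<alpha> \<beta> x y) z u = P \<delta> (tr e (br ?x ?y) ?z)"
        unfolding u G_brA[symmetric] by (rule theta) (simp_all add: \<delta>_def ac_simps)
      moreover have "thetaW \<alpha> \<gamma> (\<beta> * \<sigma>) x z (rhoW \<beta> \<sigma> y u) = P \<delta> (tr (br ?y e) ?x ?z)"
        unfolding u by (subst rho[OF refl refl], rule theta) (simp_all add: \<delta>_def ac_simps)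
      moreover have "thetaW \<beta> \<gamma> (\<alpha> * \<sigma>) y z (rhoW \<alpha> \<sigma> x u) = P \<delta> (tr (br ?x e) ?y ?z)"
        unfolding u by (subst rho[OF refl refl], rule theta) (simp_all add: \<delta>_def ac_simps)
      \<comment> \<open>The cyclic identity \<open>ly2\<close> for \<open>x\<close>,
        \<open>y\<close>, \<open>e\<close>, after moving \<open>e\<close> by skew-symmetry.\<close>
      moreover have "tr e (br ?x ?y) ?z - tr (br ?y e) ?x ?z + tr (br ?x e) ?y ?z = 0"
        using ly2[of ?x ?y e ?z] tr_skew[of e "br ?x ?y" ?z] br_skew[of e ?x]
        by (simp add: tr_simps algebra_simps)
      ultimately show ?thesis by (simp add: P_simps(4) flip: P_simps(1,2))
    qed
    show "omega_D brA rhoW thetaW \<alpha> \<beta> (\<gamma> * \<sigma>) x y (rhoW \<gamma> \<sigma> z u)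
       - rhoW \<gamma> (\<alpha> * \<beta> * \<sigma>) z (omega_D brA rhoW thetaW \<alpha> \<beta> \<sigma> x y u)
       - rhoW (\<alpha> * \<beta> * \<gamma>) \<sigma> (trA \<alpha> \<beta> \<gamma> x y z) u = 0"
    proof -
      define \<delta> where "\<delta> = \<alpha> * \<beta> * \<gamma> * \<sigma>"
      let ?x = "G \<alpha> x" and ?y = "G \<beta> y" and ?z = "G \<gamma> z"
      have "omega_D brA rhoW thetaW \<alpha> \<beta> (\<gamma> * \<sigma>) x y (rhoW \<gamma> \<sigma> z u) = P \<delta> (tr ?x ?y (br ?z e))"
        unfolding u by (subst rho[OF refl refl], rule D) (simp_all add: \<delta>_def ac_simps)
      moreover have "rhoW \<gamma> (\<alpha> * \<beta> * \<sigma>) z (omega_D brA rhoW thetaW \<alpha> \<beta> \<sigma> x y u)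
        = P \<delta> (br ?z (tr ?x ?y e))"
        unfolding u by (subst D[OF refl refl], rule rho) (simp_all add: \<delta>_def ac_simps)
      moreover have "rhoW (\<alpha> * \<beta> * \<gamma>) \<sigma> (trA \<alpha> \<beta> \<gamma> x y z) u = P \<delta> (br (tr ?x ?y ?z) e)"
        unfolding u G_trA[symmetric] by (rule rho) (simp_all add: \<delta>_def ac_simps)
      \<comment> \<open>\<open>tr x y\<close> is a derivation of the bracket.\<close>
      moreover have "tr ?x ?y (br ?z e) - br ?z (tr ?x ?y e) - br (tr ?x ?y ?z) e = 0"
        by (simp add: ly3)
      ultimately show ?thesis by (simp add: P_simps(4) flip: P_simps(1,2))
    qed
    show "thetaW \<alpha> (\<beta> * \<gamma>) \<sigma> x (brA \<beta> \<gamma> y z) u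
       - rhoW \<beta> (\<alpha> * \<gamma> * \<sigma>) y (thetaW \<alpha> \<gamma> \<sigma> x z u)
       + rhoW \<gamma> (\<alpha> * \<beta> * \<sigma>) z (thetaW \<alpha> \<beta> \<sigma> x y u) = 0"
    proof -
      define \<delta> where "\<delta> = \<alpha> * \<beta> * \<gamma> * \<sigma>"
      let ?x = "G \<alpha> x" and ?y = "G \<beta> y" and ?z = "G \<gamma> z"
      have "thetaW \<alpha> (\<beta> * \<gamma>) \<sigma> x (brA \<beta> \<gamma> y z) u = P \<delta> (tr e ?x (br ?y ?z))"
        unfolding u G_brA[symmetric] by (rule theta) (simp_all add: \<delta>_def ac_simps)
      moreover have "rhoW \<beta> (\<alpha> * \<gamma> * \<sigma>) y (thetaW \<alpha> \<gamma> \<sigma> x z u) = P \<delta> (br ?y (tr e ?x ?z))"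
        unfolding u by (subst theta[OF refl refl], rule rho) (simp_all add: \<delta>_def ac_simps)
      moreover have "rhoW \<gamma> (\<alpha> * \<beta> * \<sigma>) z (thetaW \<alpha> \<beta> \<sigma> x y u) = P \<delta> (br ?z (tr e ?x ?y))"
        unfolding u by (subst theta[OF refl refl], rule rho) (simp_all add: \<delta>_def ac_simps)
      \<comment> \<open>Again the derivation rule, now for \<open>tr e x\<close>: the element being
        acted on is part of the derivation.\<close>
      moreover have "tr e ?x (br ?y ?z) - br ?y (tr e ?x ?z) + br ?z (tr e ?x ?y) = 0"
        by (simp add: ly3 br_skew[of "tr e ?x ?y"])
      ultimately show ?thesis by (simp add: P_simps(4) flip: P_simps(1,2))
    qed
    show "omega_D brA rhoW thetaW \<tau> \<alpha> (\<beta> * \<gamma> * \<sigma>) a x (thetaW \<beta> \<gamma> \<sigma> y z u)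
       - thetaW \<beta> \<gamma> (\<tau> * \<alpha> * \<sigma>) y z (omega_D brA rhoW thetaW \<tau> \<alpha> \<sigma> a x u)
       - thetaW (\<tau> * \<alpha> * \<beta>) \<gamma> \<sigma> (trA \<tau> \<alpha> \<beta> a x y) z u
       - thetaW \<beta> (\<tau> * \<alpha> * \<gamma>) \<sigma> y (trA \<tau> \<alpha> \<gamma> a x z) u = 0"
    proof -
      define \<delta> where "\<delta> = \<tau> * \<alpha> * \<beta> * \<gamma> * \<sigma>"
      let ?x = "G \<alpha> x" and ?y = "G \<beta> y" and ?z = "G \<gamma> z"
      have "omega_D brA rhoW thetaW \<tau> \<alpha> (\<beta> * \<gamma> * \<sigma>) a x (thetaW \<beta> \<gamma> \<sigma> y z u)
        = P \<delta> (tr ?a ?x (tr e ?y ?z))"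
        unfolding u by (subst theta[OF refl refl], rule D) (simp_all add: \<delta>_def ac_simps)
      moreover have "thetaW \<beta> \<gamma> (\<tau> * \<alpha> * \<sigma>) y z (omega_D brA rhoW thetaW \<tau> \<alpha> \<sigma> a x u)
        = P \<delta> (tr (tr ?a ?x e) ?y ?z)"
        unfolding u by (subst D[OF refl refl], rule theta) (simp_all add: \<delta>_def ac_simps)
      moreover have "thetaW (\<tau> * \<alpha> * \<beta>) \<gamma> \<sigma> (trA \<tau> \<alpha> \<beta> a x y) z u
        = P \<delta> (tr e (tr ?a ?x ?y) ?z)"
        unfolding u G_trA[symmetric] by (rule theta) (simp_all add: \<delta>_def ac_simps)
      moreover have "thetaW \<beta> (\<tau> * \<alpha> * \<gamma>) \<sigma> y (trA \<tau> \<alpha> \<gamma> a x z) u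
        = P \<delta> (tr e ?y (tr ?a ?x ?z))"
        unfolding u G_trA[symmetric] by (rule theta) (simp_all add: \<delta>_def ac_simps)
      \<comment> \<open>The derivation \<open>tr a x\<close> applied to the triple \<open>e\<close>,
        \<open>y\<close>, \<open>z\<close>.\<close>
      ultimately show ?thesis by (simp add: ly4[of ?a ?x e] P_simps)
    qed
    show "thetaW \<tau> (\<alpha> * \<beta> * \<gamma>) \<sigma> a (trA \<alpha> \<beta> \<gamma> x y z) u
       - thetaW \<beta> \<gamma> (\<tau> * \<alpha> * \<sigma>) y z (thetaW \<tau> \<alpha> \<sigma> a x u)
       + thetaW \<alpha> \<gamma> (\<tau> * \<beta> * \<sigma>) x z (thetaW \<tau> \<beta> \<sigma> a y u)
       - omega_D brA rhoW thetaW \<alpha> \<beta> (\<tau> * \<gamma> * \<sigma>) x y (thetaW \<tau> \<gamma> \<sigma> a z u) = 0"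
    proof -
      define \<delta> where "\<delta> = \<tau> * \<alpha> * \<beta> * \<gamma> * \<sigma>"
      let ?x = "G \<alpha> x" and ?y = "G \<beta> y" and ?z = "G \<gamma> z"
      have "thetaW \<tau> (\<alpha> * \<beta> * \<gamma>) \<sigma> a (trA \<alpha> \<beta> \<gamma> x y z) u = P \<delta> (tr e ?a (tr ?x ?y ?z))"
        unfolding u G_trA[symmetric] by (rule theta) (simp_all add: \<delta>_def ac_simps)
      moreover have "thetaW \<beta> \<gamma> (\<tau> * \<alpha> * \<sigma>) y z (thetaW \<tau> \<alpha> \<sigma> a x u)
        = P \<delta> (tr (tr e ?a ?x) ?y ?z)"
        unfolding u by (subst theta[OF refl refl], rule theta) (simp_all add: \<delta>_def ac_simps)
      moreover have "thetaW \<alpha> \<gamma> (\<tau> * \<beta> * \<sigma>) x z (thetaW \<tau> \<beta> \<sigma> a y u)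
        = P \<delta> (tr (tr e ?a ?y) ?x ?z)"
        unfolding u by (subst theta[OF refl refl], rule theta) (simp_all add: \<delta>_def ac_simps)
      moreover have "omega_D brA rhoW thetaW \<alpha> \<beta> (\<tau> * \<gamma> * \<sigma>) x y (thetaW \<tau> \<gamma> \<sigma> a z u)
        = P \<delta> (tr ?x ?y (tr e ?a ?z))"
        unfolding u by (subst theta[OF refl refl], rule D) (simp_all add: \<delta>_def ac_simps)
      \<comment> \<open>The derivation \<open>tr e a\<close> applied to \<open>x\<close>,
        \<open>y\<close>, \<open>z\<close>; skew-symmetry moves \<open>tr e a y\<close> to the first
        slot.\<close>
      ultimately show ?thesis
        by (simp add: ly4[of e ?a ?x] tr_skew[of ?x "tr e ?a ?y"] P_simps)
    qed
  qed
qed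

end

section \<open>Identities for \<open>D\<close> in a representation of a Lie-Yamaguti algebra\<close>

context ly_representation
begin

abbreviation "D \<equiv> ly_D br \<rho> \<theta>"

lemmas rho_simps = bilinear_map_simps[OF rho_bilinear]
lemmas theta_simps = trilinear_map_simps[OF theta_trilinear]

lemma rep1': "\<theta> (br x y) z v = \<theta> x z (\<rho> y v) - \<theta> y z (\<rho> x v)"
  using rep1[of x y z v] by (simp add: algebra_simps)

lemma rep2': "D x y (\<rho> z v) = \<rho> z (D x y v) + \<rho> (tr x y z) v"
  using rep2[of x y z v] by (simp add: algebra_simps)

lemma rep3': "\<theta> x (br y z) v = \<rho> y (\<theta> x z v) - \<rho> z (\<theta> x y v)"
  using rep3[of x y z v] by (simp add: algebra_simps)

lemma rep4': "D a b (\<theta> x y v) = \<theta> x y (D a b v) + \<theta> (tr a b x) y v + \<theta> x (tr a b y) v"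
  using rep4[of a b x y v] by (simp add: algebra_simps)

lemma rep5': "\<theta> a (tr x y z) v = \<theta> y z (\<theta> a x v) - \<theta> x z (\<theta> a y v) + D x y (\<theta> a z v)"
  using rep5[of a x y z v] by (simp add: algebra_simps)

lemma D_simps:
  "D (x + x') y v = D x y v + D x' y v" "D (x - x') y v = D x y v - D x' y v"
  "D (- x) y v = - D x y v"
  "D x (y + y') v = D x y v + D x y' v"
  "D x y (v + v') = D x y v + D x y v'" "D x y (v - v') = D x y v - D x y v'"
  "D x y (- v) = - D x y v"
  "D x y 0 = 0"
  by (simp_all add: ly_D_def br_simps rho_simps theta_simps algebra_simps)

lemma D_alternating: "D x x v = 0"
  using br_hom by (simp add: ly_D_def hom_wedge2_def rho_simps)

text \<open>Apply \<rho> to \<open>ly1\<close> and replace each \<rho> of a triple product by a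
  commutator of \<open>D\<close> with \<rho>, using \<open>rep2'\<close>. Expanding \<open>D\<close>
  and rewriting the \<theta> terms by \<open>rep1'\<close> and \<open>rep3'\<close> gives the
  claim.\<close>

lemma D_cyclic: "D (br x y) z v + D (br y z) x v + D (br z x) y v = 0"
proof -
  have "\<rho> (br (br x y) z + br (br y z) x + br (br z x) y + tr x y z + tr z x y + tr y z x) v = 0"
    by (simp add: ly1 rho_simps)
  then have "\<rho> (br (br x y) z) v + \<rho> (br (br y z) x) v + \<rho> (br (br z x) y) v
      + (D x y (\<rho> z v) - \<rho> z (D x y v)) + (D z x (\<rho> y v) - \<rho> y (D z x v))
      + (D y z (\<rho> x v) - \<rho> x (D y z v)) = 0"
    by (simp add: rep2' rho_simps)
  then show ?thesis
    by (simp add: ly_D_def rep1' rep3' rho_simps theta_simps algebra_simps)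
qed

text \<open>\<open>D a b\<close> obeys a derivation rule for each ingredient of
  \<open>D x y\<close>: \<rho> by \<open>rep2'\<close>, \<theta> by \<open>rep4'\<close>, the
  bracket by \<open>ly3\<close>.\<close>

lemma D_commutator: "D a b (D x y v) = D x y (D a b v) + D (tr a b x) y v + D x (tr a b y) v"
  \<comment> \<open>The chosen instances leave \<open>D a b\<close> folded, so that these rules can
    still rewrite it.\<close>
  unfolding ly_D_def[of _ _ _ x y v] ly_D_def[of _ _ _ x y "D a b v"]
    ly_D_def[of _ _ _ "tr a b x"] ly_D_def[of _ _ _ x "tr a b y"]
  by (simp add: D_simps rep2' rep4' ly3 rho_simps algebra_simps)

end

section \<open>The abelian extension of \<open>L\<close> by \<open>V\<close> determined by a
  cocycle\<close>

locale ly_cocycle = ly_representation sL br tr sV \<rho> \<theta>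
  for sL :: "'k::field \<Rightarrow> 'l::ab_group_add \<Rightarrow> 'l"
    and br :: "'l \<Rightarrow> 'l \<Rightarrow> 'l"
    and tr :: "'l \<Rightarrow> 'l \<Rightarrow> 'l \<Rightarrow> 'l"
    and sV :: "'k \<Rightarrow> 'v::ab_group_add \<Rightarrow> 'v"
    and \<rho> :: "'l \<Rightarrow> 'v \<Rightarrow> 'v"
    and \<theta> :: "'l \<Rightarrow> 'l \<Rightarrow> 'v \<Rightarrow> 'v" +
  fixes \<Gamma>1 :: "'l \<Rightarrow> 'l \<Rightarrow> 'v"
    and \<Gamma>2 :: "'l \<Rightarrow> 'l \<Rightarrow> 'l \<Rightarrow> 'v"
  assumes cocycle: "(\<Gamma>1, \<Gamma>2) \<in> cocycles23 sL br tr sV \<rho> \<theta>"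
begin

text \<open>Semidirect product operations twisted by \<Gamma>. On pairs
  \<open>(T \<alpha> u, u)\<close> the \<open>V\<close>-components of \<open>brE\<close> and
  \<open>trE\<close> are exactly the arguments of \<open>T\<close> in the twisted Rota-Baxter
  identities.\<close>

fun brE :: "'l \<times> 'v \<Rightarrow> 'l \<times> 'v \<Rightarrow> 'l \<times> 'v" where
  "brE (x, u) (y, v) = (br x y, \<rho> x v - \<rho> y u + \<Gamma>1 x y)"

fun trE :: "'l \<times> 'v \<Rightarrow> 'l \<times> 'v \<Rightarrow> 'l \<times> 'v \<Rightarrow> 'l \<times> 'v" where
  "trE (x, u) (y, v) (z, w) = (tr x y z, D x y w - \<theta> x z v + \<theta> y z u + \<Gamma>2 x y z)"

definition sE :: "'k \<Rightarrow> 'l \<times> 'v \<Rightarrow> 'l \<times> 'v" where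
  "sE c = map_prod (sL c) (sV c)"

lemma Gamma1_hom: "\<Gamma>1 \<in> hom_wedge2 sL sV" and Gamma2_hom: "\<Gamma>2 \<in> hom_wedge2_tensor sL sV"
  using cocycle by (auto simp: cocycles23_def)

lemma Gamma1_bilinear: "bilinear_map sL sL sV \<Gamma>1"
  and Gamma2_trilinear: "trilinear_map sL sL sL sV \<Gamma>2"
  using Gamma1_hom Gamma2_hom by (auto simp: hom_wedge2_def hom_wedge2_tensor_def)

lemmas Gamma1_simps = bilinear_map_simps[OF Gamma1_bilinear]
lemmas Gamma2_simps = trilinear_map_simps[OF Gamma2_trilinear]

lemma cocycle1:
  "- \<rho> x (\<Gamma>1 y z) - \<rho> y (\<Gamma>1 z x) - \<rho> z (\<Gamma>1 x y)
   + \<Gamma>1 (br x y) z + \<Gamma>1 (br y z) x + \<Gamma>1 (br z x) y + \<Gamma>2 x y z + \<Gamma>2 y z x + \<Gamma>2 z x y = 0"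
  using cocycle by (simp add: cocycles23_def)

lemma cocycle2:
  "\<theta> x a (\<Gamma>1 y z) + \<theta> y a (\<Gamma>1 z x) + \<theta> z a (\<Gamma>1 x y)
   + \<Gamma>2 (br x y) z a + \<Gamma>2 (br y z) x a + \<Gamma>2 (br z x) y a = 0"
  using cocycle by (simp add: cocycles23_def)

text \<open>The two sides collect the \<Gamma> terms in the \<open>V\<close>-components of the two
  sides of \<open>ly3\<close> for the extension; \<open>cocycle4\<close> does the same for
  \<open>ly4\<close>.\<close>

lemma cocycle3:
  "\<Gamma>2 a b (br x y) + D a b (\<Gamma>1 x y)
   = \<rho> x (\<Gamma>2 a b y) - \<rho> y (\<Gamma>2 a b x) + \<Gamma>1 (tr a b x) y + \<Gamma>1 x (tr a b y)"
proof -
  have "- \<rho> x (\<Gamma>2 a b y) + \<rho> y (\<Gamma>2 a b x) + \<Gamma>2 a b (br x y) + D a b (\<Gamma>1 x y)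
        - \<Gamma>1 (tr a b x) y - \<Gamma>1 x (tr a b y) = 0"
    using cocycle by (simp add: cocycles23_def)
  then show ?thesis by (simp add: algebra_simps)
qed

lemma cocycle4:
  "\<Gamma>2 a b (tr x y z) + D a b (\<Gamma>2 x y z)
   = \<theta> y z (\<Gamma>2 a b x) - \<theta> x z (\<Gamma>2 a b y) + D x y (\<Gamma>2 a b z)
     + \<Gamma>2 (tr a b x) y z + \<Gamma>2 x (tr a b y) z + \<Gamma>2 x y (tr a b z)"
proof -
  have "- \<theta> y z (\<Gamma>2 a b x) + \<theta> x z (\<Gamma>2 a b y)
        + D a b (\<Gamma>2 x y z) - D x y (\<Gamma>2 a b z)
        - \<Gamma>2 (tr a b x) y z - \<Gamma>2 x (tr a b y) z
        + \<Gamma>2 a b (tr x y z) - \<Gamma>2 x y (tr a b z) = 0"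
    using cocycle by (simp add: cocycles23_def)
  then show ?thesis by (simp add: algebra_simps)
qed

lemma vector_space_E: "vector_space sE"
  by unfold_locales
    (auto simp: sE_def scale_right_distrib scale_left_distrib V.scale_right_distrib
      V.scale_left_distrib)

lemma br_scale: "br (sL c x) y = sL c (br x y)" "br x (sL c y) = sL c (br x y)"
  using br_bilinear by (auto simp: bilinear_map_def Vector_Spaces.linear_iff)

lemma tr_scale: "tr (sL c x) y z = sL c (tr x y z)" "tr x (sL c y) z = sL c (tr x y z)"
  "tr x y (sL c z) = sL c (tr x y z)"
  using tr_trilinear by (auto simp: trilinear_map_def Vector_Spaces.linear_iff)

lemma rho_scale: "\<rho> (sL c x) v = sV c (\<rho> x v)" "\<rho> x (sV c v) = sV c (\<rho> x v)"
  using rho_bilinear by (auto simp: bilinear_map_def Vector_Spaces.linear_iff)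

lemma theta_scale: "\<theta> (sL c x) y v = sV c (\<theta> x y v)" "\<theta> x (sL c y) v = sV c (\<theta> x y v)"
  "\<theta> x y (sV c v) = sV c (\<theta> x y v)"
  using theta_trilinear by (auto simp: trilinear_map_def Vector_Spaces.linear_iff)

lemma D_scale: "D (sL c x) y v = sV c (D x y v)" "D x (sL c y) v = sV c (D x y v)"
  "D x y (sV c v) = sV c (D x y v)"
  by (simp_all add: ly_D_def br_scale rho_scale theta_scale
      V.scale_right_distrib V.scale_right_diff_distrib)

lemma Gamma1_scale: "\<Gamma>1 (sL c x) y = sV c (\<Gamma>1 x y)" "\<Gamma>1 x (sL c y) = sV c (\<Gamma>1 x y)"
  using Gamma1_bilinear by (auto simp: bilinear_map_def Vector_Spaces.linear_iff)

lemma Gamma2_scale: "\<Gamma>2 (sL c x) y z = sV c (\<Gamma>2 x y z)" "\<Gamma>2 x (sL c y) z = sV c (\<Gamma>2 x y z)"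
  "\<Gamma>2 x y (sL c z) = sV c (\<Gamma>2 x y z)"
  using Gamma2_trilinear by (auto simp: trilinear_map_def Vector_Spaces.linear_iff)

lemma brE_hom: "brE \<in> hom_wedge2 sE sE"
  using vector_space_E br_hom Gamma1_hom
  by (auto simp: hom_wedge2_def bilinear_map_def Vector_Spaces.linear_iff sE_def
      br_simps rho_simps Gamma1_simps br_scale rho_scale Gamma1_scale
      V.scale_right_distrib V.scale_right_diff_distrib zero_prod_def)

lemma trE_hom: "trE \<in> hom_wedge2_tensor sE sE"
  using vector_space_E tr_hom Gamma2_hom
  by (auto simp: hom_wedge2_tensor_def trilinear_map_def Vector_Spaces.linear_iff sE_def
      tr_simps theta_simps D_simps Gamma2_simps tr_scale theta_scale D_scale Gamma2_scale
      V.scale_right_distrib V.scale_right_diff_distrib D_alternating zero_prod_def)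

text \<open>The \<open>L\<close>-components are the axioms of \<open>L\<close>. In the
  \<open>V\<close>-components the \<Gamma> terms cancel by the cocycle conditions, and the remaining
  terms by the representation identities.\<close>

lemma lie_yamaguti_extension: "lie_yamaguti_algebra sE brE trE"
proof -
  interpret E: vector_space sE by (rule vector_space_E)
  show ?thesis
  proof
    show "brE \<in> hom_wedge2 sE sE" "trE \<in> hom_wedge2_tensor sE sE"
      by (rule brE_hom trE_hom)+
    fix X Y Z A B :: "'l \<times> 'v"
    obtain x u y v z w a r b s where
      XYZ: "X = (x, u)" "Y = (y, v)" "Z = (z, w)" "A = (a, r)" "B = (b, s)"
      by (metis surj_pair)
    show "brE (brE X Y) Z + brE (brE Y Z) X + brE (brE Z X) Y
      + trE X Y Z + trE Z X Y + trE Y Z X = 0"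
      \<comment> \<open>The terms in \<open>u\<close>, \<open>v\<close>, \<open>w\<close> cancel by
        the very definition of \<open>D\<close>.\<close>
      using ly1[of x y z] cocycle1[of x y z]
      by (simp add: XYZ zero_prod_def rho_simps ly_D_def algebra_simps)
    show "trE (brE X Y) Z A + trE (brE Y Z) X A + trE (brE Z X) Y A = 0"
      \<comment> \<open>The terms in \<open>r\<close> cancel by \<open>D_cyclic\<close>, those in
        \<open>u\<close>, \<open>v\<close>, \<open>w\<close> by \<open>rep1'\<close>.\<close>
      using ly2[of x y z a] cocycle2[of x a y z] D_cyclic[of x y z r]
      by (simp add: XYZ zero_prod_def theta_simps rep1' algebra_simps)
    show "trE A B (brE X Y) = brE (trE A B X) Y + brE X (trE A B Y)"
      using ly3[of a b x y] cocycle3[of a b x y]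
      by (simp add: XYZ D_simps rho_simps rep2' rep3' algebra_simps)
    show "trE A B (trE X Y Z) = trE (trE A B X) Y Z + trE X (trE A B Y) Z + trE X Y (trE A B Z)"
      \<comment> \<open>Terms in \<open>w\<close> need \<open>D_commutator\<close>, terms in
        \<open>u\<close> and \<open>v\<close> need \<open>rep4'\<close>, and terms in
        \<open>r\<close> and \<open>s\<close> need \<open>rep5'\<close>.\<close>
      using ly4[of a b x y z] cocycle4[of a b x y z] D_commutator[of a b x y w]
      by (simp add: XYZ D_simps theta_simps rep4'[of a b] rep5'[of _ x y z] algebra_simps)
  qed
qed

end

section \<open>The graphs of a twisted Rota-Baxter family inside the extension\<close>

theorem theorem6p1:
  fixes sL :: "'k::alg_closed_field \<Rightarrow> 'l::ab_group_add \<Rightarrow> 'l"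
    and br :: "'l \<Rightarrow> 'l \<Rightarrow> 'l"
    and tr :: "'l \<Rightarrow> 'l \<Rightarrow> 'l \<Rightarrow> 'l"
    and sV :: "'k \<Rightarrow> 'v::ab_group_add \<Rightarrow> 'v"
    and \<rho> :: "'l \<Rightarrow> 'v \<Rightarrow> 'v"
    and \<theta> :: "'l \<Rightarrow> 'l \<Rightarrow> 'v \<Rightarrow> 'v"
    and \<Gamma>1 :: "'l \<Rightarrow> 'l \<Rightarrow> 'v"
    and \<Gamma>2 :: "'l \<Rightarrow> 'l \<Rightarrow> 'l \<Rightarrow> 'v"
    and T :: "'w::ab_semigroup_mult \<Rightarrow> 'v \<Rightarrow> 'l"
  assumes "CHAR('k) \<noteq> 2" and "CHAR('k) \<noteq> 3"
    and "ly_representation sL br tr sV \<rho> \<theta>"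
    and "(\<Gamma>1, \<Gamma>2) \<in> cocycles23 sL br tr sV \<rho> \<theta>"
    and "twisted_rota_baxter_family sL br tr sV \<rho> \<theta> (\<Gamma>1, \<Gamma>2) T"
  shows "omega_ly_representation sV
    (\<lambda>\<alpha> \<beta> u v. \<rho> (T \<alpha> u) v - \<rho> (T \<beta> v) u + \<Gamma>1 (T \<alpha> u) (T \<beta> v))
    (\<lambda>\<alpha> \<beta> \<gamma> u v w. ly_D br \<rho> \<theta> (T \<alpha> u) (T \<beta> v) w + \<theta> (T \<beta> v) (T \<gamma> w) u
        - \<theta> (T \<alpha> u) (T \<gamma> w) v + \<Gamma>2 (T \<alpha> u) (T \<beta> v) (T \<gamma> w))
    sL
    (\<lambda>\<alpha> \<sigma> u x. br (T \<alpha> u) x + T (\<sigma> * \<alpha>) (\<rho> x u + \<Gamma>1 x (T \<alpha> u)))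
    (\<lambda>\<alpha> \<beta> \<sigma> u v x. tr x (T \<alpha> u) (T \<beta> v)
        - T (\<sigma> * \<alpha> * \<beta>) (ly_D br \<rho> \<theta> x (T \<alpha> u) v - \<theta> x (T \<beta> v) u
            + \<Gamma>2 x (T \<alpha> u) (T \<beta> v)))"
proof -
  interpret ly_representation sL br tr sV \<rho> \<theta> by fact
  interpret ly_cocycle sL br tr sV \<rho> \<theta> \<Gamma>1 \<Gamma>2 by unfold_locales fact
  have T_linear: "Vector_Spaces.linear sV sL (T \<alpha>)" for \<alpha>
    using assms(5) by (simp add: twisted_rota_baxter_family_def)
  have T_br: "br (T \<alpha> u) (T \<beta> v)
      = T (\<alpha> * \<beta>) (\<rho> (T \<alpha> u) v - \<rho> (T \<beta> v) u + \<Gamma>1 (T \<alpha> u) (T \<beta> v))" for \<alpha> \<beta> u v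
    using assms(5) by (simp add: twisted_rota_baxter_family_def)
  have T_tr: "tr (T \<alpha> u) (T \<beta> v) (T \<gamma> w)
      = T (\<alpha> * \<beta> * \<gamma>) (D (T \<alpha> u) (T \<beta> v) w - \<theta> (T \<alpha> u) (T \<gamma> w) v
          + \<theta> (T \<beta> v) (T \<gamma> w) u + \<Gamma>2 (T \<alpha> u) (T \<beta> v) (T \<gamma> w))" for \<alpha> \<beta> \<gamma> u v w
    using assms(5) by (simp add: twisted_rota_baxter_family_def)
  note T_simps = linear_simps[OF T_linear]
  have T_scale: "T \<alpha> (sV c u) = sL c (T \<alpha> u)" for \<alpha> c u
    using T_linear by (simp add: Vector_Spaces.linear_iff)
  interpret E: lie_yamaguti_algebra sE brE trE by (rule lie_yamaguti_extension)
  have vs: "vector_space sE" "vector_space sL" "vector_space sV" by unfold_locales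
  interpret G: split_graded_subalgebra sE brE trE sV sL
    "\<lambda>\<alpha> u. (T \<alpha> u, u)" snd "\<lambda>\<alpha> (x, u). x - T \<alpha> u" "\<lambda>x. (x, 0)"
  proof (intro split_graded_subalgebra.intro split_graded_subalgebra_axioms.intro
      lie_yamaguti_extension vs)
    fix \<alpha> \<beta> \<gamma> u v z and x :: 'l and e
    show "Vector_Spaces.linear sV sE (\<lambda>u. (T \<alpha> u, u))"
      using vs by (auto simp: Vector_Spaces.linear_iff sE_def T_simps T_scale)
    show "Vector_Spaces.linear sE sV snd"
      using vs by (auto simp: Vector_Spaces.linear_iff sE_def)
    show "Vector_Spaces.linear sE sL (\<lambda>(x, u). x - T \<alpha> u)"
      using vs by (auto simp: Vector_Spaces.linear_iff sE_def T_simps T_scale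
          scale_right_diff_distrib)
    show "Vector_Spaces.linear sL sE (\<lambda>x. (x, 0))"
      using vs by (auto simp: Vector_Spaces.linear_iff sE_def)
    show "snd (T \<alpha> u, u) = u" by simp
    show "(case (x, 0) of (x, u) \<Rightarrow> x - T \<alpha> u) = x" by (simp add: T_simps)
    show "(case e of (x, u) \<Rightarrow> x - T \<alpha> u) = 0 \<longleftrightarrow> e \<in> range (\<lambda>u. (T \<alpha> u, u))"
      by (cases e) auto
    \<comment> \<open>The witness is the \<open>V\<close>-component of the product; the Rota-Baxter
      identity says that \<open>T\<close> sends it to the \<open>L\<close>-component.\<close>
    show "brE (T \<alpha> u, u) (T \<beta> v, v) \<in> range (\<lambda>u. (T (\<alpha> * \<beta>) u, u))"
      by (simp add: T_br image_iff)
    show "trE (T \<alpha> u, u) (T \<beta> v, v) (T \<gamma> z, z) \<in> range (\<lambda>u. (T (\<alpha> * \<beta> * \<gamma>) u, u))"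
      by (simp add: T_tr image_iff)
  qed
  have "G.brA = (\<lambda>\<alpha> \<beta> u v. \<rho> (T \<alpha> u) v - \<rho> (T \<beta> v) u + \<Gamma>1 (T \<alpha> u) (T \<beta> v))"
    by (intro ext) (simp add: G.brA_def)
  moreover have "G.trA = (\<lambda>\<alpha> \<beta> \<gamma> u v w. D (T \<alpha> u) (T \<beta> v) w + \<theta> (T \<beta> v) (T \<gamma> w) u
        - \<theta> (T \<alpha> u) (T \<gamma> w) v + \<Gamma>2 (T \<alpha> u) (T \<beta> v) (T \<gamma> w))"
    by (intro ext) (simp add: G.trA_def algebra_simps)
  \<comment> \<open>Projecting subtracts \<open>T\<close> of a \<open>V\<close>-component containing
    \<open>- \<rho> x u + \<Gamma>1 (T \<alpha> u) x\<close>; skew-symmetry of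
    \<open>\<Gamma>1\<close> then gives the plus signs of the stated formula.\<close>
  moreover have "G.rhoW = (\<lambda>\<alpha> \<sigma> u x. br (T \<alpha> u) x + T (\<sigma> * \<alpha>) (\<rho> x u + \<Gamma>1 x (T \<alpha> u)))"
    by (intro ext) (simp add: G.rhoW_def T_simps rho_simps
        hom_wedge2_skew[OF Gamma1_hom, of "T _ _"])
  \<comment> \<open>The representative \<open>(x, 0)\<close> has zero \<open>V\<close>-component, so
    one of the two \<theta> terms of \<open>trE\<close> vanishes.\<close>
  moreover have "G.thetaW = (\<lambda>\<alpha> \<beta> \<sigma> u v x. tr x (T \<alpha> u) (T \<beta> v)
        - T (\<sigma> * \<alpha> * \<beta>) (D x (T \<alpha> u) v - \<theta> x (T \<beta> v) u + \<Gamma>2 x (T \<alpha> u) (T \<beta> v)))"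
    by (intro ext) (simp add: G.thetaW_def theta_simps)
  ultimately show ?thesis
    using G.omega_representation by simp
qed

end
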